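(* Let $\mu_1,\ldots,\mu_k$ be mean $0$ probability measures in $\mathbb{R}^d$, where $d\ge 2k+1$, with $2+\beta$ moments, for some $\beta>0$. Then the random walk $X$ generated by these measures and an arbitrary adapted rule $\ell$ is transient.
   Context: Conventions. $\|\cdot\|$ is the Euclidean norm on $\mathbb{R}^d$. A probability measure $\mu$ on $\mathbb{R}^d$ has mean $0$ if $\int_{\mathbb{R}^d} x\,\mu(dx)=0$, and has $\gamma$ moments if $\mathbb{E}[\|Z\|^{\gamma}]<\infty$ for $Z\sim\mu$. Walk generated by measures and an adapted rule. Let $\mu_1,\ldots,\mu_k$ be probability measures on $\mathbb{R}^d$ and, for each $j=1,\ldots,k$, let $\xi^j_1,\xi^j_2,\ldots$ be i.i.d. with law $\mu_j$. An adapted rule $\ell=(\ell(i))_{i\ge 0}$ with respect to a filtration $(\mathcal{F}_i)_{i\ge 0}$ is a process such that $\ell(i)\in\{1,\ldots,k\}$ and $\ell(i)$ is $\mathcal{F}_i$-measurable for all $i$. Here the filtration represents the history of the process: $\xi^j_i$ is $\mathcal{F}_i$-measurable for all $i\ge 1$ and all $j$, and $(\xi^1_{i+1},\ldots,\xi^k_{i+1})$ is independent of $\mathcal{F}_i$ for all $i\ge 0$. The walk $X$ generated by $\mu_1,\ldots,\mu_k$ and the rule $\ell$ is defined by $X_0=0$ and $X_{i+1}=X_i+\xi^{\ell(i)}_{i+1}$. Transient means that almost surely $\|X_t\|\to\infty$ as $t\to\infty$.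
   Formalization: Each μ_j is additionally assumed to be genuinely d-dimensional (no proper linear subspace of R^d carries all its mass); without this the claim fails, e.g. for k = 1 and μ_1 the point mass at 0, where the walk never leaves the origin. *)

theory Defs
  imports "HOL-Probability.Probability"
begin

text \<open>
  A measure on a Euclidean space is d-dimensional (d being the dimension of that space) if no
  proper linear subspace carries all of its mass. For measures with mean 0, which are the only
  ones considered here, proper affine subspaces would give the same notion. The condition is
  needed: with the Dirac mass at 0 among the steps, a walk can stay at the origin for ever.
\<close>
definition full_dimensional :: "'a::euclidean_space measure \<Rightarrow> bool" where
  "full_dimensional \<mu> \<longleftrightarrow> (\<forall>V. subspace V \<and> V \<noteq> UNIV \<longrightarrow> \<not> (AE x in \<mu>. x \<in> V))"

definition mean_zero :: "'a::euclidean_space measure \<Rightarrow> bool" where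
  "mean_zero \<mu> \<longleftrightarrow> has_bochner_integral \<mu> (\<lambda>x. x) 0"

definition has_moments :: "real \<Rightarrow> 'a::euclidean_space measure \<Rightarrow> bool" where
  "has_moments \<gamma> \<mu> \<longleftrightarrow> integrable \<mu> (\<lambda>x. norm x powr \<gamma>)"

text \<open>
  The steps \<open>\<xi> j i\<close> have measure index \<open>j \<in> {1..k}\<close> and time index \<open>i \<ge> 1\<close>; the values outside
  these ranges are irrelevant. Independence over \<open>i\<close> is required for each \<open>j\<close> separately; at a
  given time the steps with different \<open>j\<close> may depend on each other.
\<close>
definition iid_steps ::
    "'w measure \<Rightarrow> nat \<Rightarrow> (nat \<Rightarrow> 'a::euclidean_space measure) \<Rightarrow> (nat \<Rightarrow> nat \<Rightarrow> 'w \<Rightarrow> 'a) \<Rightarrow> bool" where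
  "iid_steps M k \<mu> \<xi> \<longleftrightarrow>
     (\<forall>j\<in>{1..k}. prob_space.indep_vars M (\<lambda>_. borel) (\<xi> j) {1..} \<and>
                 (\<forall>i\<ge>1. distr M borel (\<xi> j i) = \<mu> j))"

text \<open>
  The filtration \<open>F\<close> represents the history: it contains the steps up to the present time, and
  the vector of the next steps is independent of it. The \<open>\<sigma>\<close>-algebra generated by that vector
  is the pull-back of the product \<open>\<sigma>\<close>-algebra.
\<close>
definition history_filtration ::
    "'w measure \<Rightarrow> nat \<Rightarrow> (nat \<Rightarrow> nat \<Rightarrow> 'w \<Rightarrow> 'a::euclidean_space) \<Rightarrow> (nat \<Rightarrow> 'w measure) \<Rightarrow> bool" where
  "history_filtration M k \<xi> F \<longleftrightarrow>
     filtration (space M) F \<and>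
     (\<forall>i. subalgebra M (F i)) \<and>
     (\<forall>j\<in>{1..k}. \<forall>i\<ge>1. \<xi> j i \<in> borel_measurable (F i)) \<and>
     (\<forall>i. prob_space.indep_set M (sets (F i))
            (sets (vimage_algebra (space M) (\<lambda>\<omega>. \<lambda>j\<in>{1..k}. \<xi> j (Suc i) \<omega>)
                     (Pi\<^sub>M {1..k} (\<lambda>_. borel)))))"

text \<open>Measurability into \<open>count_space {1..k}\<close> includes \<open>l i \<omega> \<in> {1..k}\<close> for all \<open>\<omega>\<close> in the space.\<close>
definition adapted_rule :: "nat \<Rightarrow> (nat \<Rightarrow> 'w measure) \<Rightarrow> (nat \<Rightarrow> 'w \<Rightarrow> nat) \<Rightarrow> bool" where
  "adapted_rule k F l \<longleftrightarrow> (\<forall>i. l i \<in> measurable (F i) (count_space {1..k}))"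

primrec walk ::
    "(nat \<Rightarrow> nat \<Rightarrow> 'w \<Rightarrow> 'a::euclidean_space) \<Rightarrow> (nat \<Rightarrow> 'w \<Rightarrow> nat) \<Rightarrow> nat \<Rightarrow> 'w \<Rightarrow> 'a" where
  "walk \<xi> l 0 \<omega> = 0"
| "walk \<xi> l (Suc i) \<omega> = walk \<xi> l i \<omega> + \<xi> (l i \<omega>) (Suc i) \<omega>"

definition transient :: "'w measure \<Rightarrow> (nat \<Rightarrow> 'w \<Rightarrow> 'a::euclidean_space) \<Rightarrow> bool" where
  "transient M X \<longleftrightarrow> (AE \<omega> in M. filterlim (\<lambda>t. norm (X t \<omega>)) at_top sequentially)"

end

theory Submission
  imports Defs
begin

text \<open>
  Let \<open>W\<close> be the law of the difference of two independent uniform points of a small ball. Its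
  Fourier transform is nonnegative, and bounded below on a large ball. Near the origin the
  characteristic function of each \<open>\<mu> j\<close> is bounded by a Gaussian \<open>exp (- c * (norm \<theta>)\<^sup>2)\<close>.

  Fix numbers \<open>n j\<close> with sum \<open>t\<close>, and consider the expected value of the Fourier transform of \<open>W\<close> at
  the endpoint of a walk that still has to make \<open>n j\<close> steps with law \<open>\<mu> j\<close>, for each \<open>j\<close>. It does not
  depend on the order of these steps, so along the adapted walk it is a supermartingale, killed when
  the rule uses some \<open>\<mu> j\<close> more than \<open>n j\<close> times. Hence the probability that at time \<open>t\<close> the walk is in
  the large ball and has used each \<open>\<mu> j\<close> exactly \<open>n j\<close> times is at most of order \<open>t powr (- d / 2)\<close>, as
  for independent steps in a fixed order. There are at most \<open>(t + 1) ^ (k - 1)\<close> choices of \<open>n\<close>, and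
  \<open>k - 1 - d / 2 < - 1\<close>, so the bounds are summable over \<open>t\<close>.
\<close>

section \<open>Characteristic functions near the origin\<close>

definition char_fun :: "'a::euclidean_space measure \<Rightarrow> 'a \<Rightarrow> complex" where
  "char_fun \<mu> \<theta> = (\<integral>x. cis (\<theta> \<bullet> x) \<partial>\<mu>)"

lemma borel_measurable_cis [measurable]: "cis \<in> borel_measurable borel"
  by (intro borel_measurable_continuous_onI continuous_intros)

text \<open>Two remainder estimates are combined: the cubic one where
  \<open>\<bar>u\<bar> \<le> 1\<close>, the quadratic one elsewhere. The exponent
  \<open>2 + b\<close> lies between them, so that \<open>2 + b\<close> moments control the error in
  the expansion of a characteristic function.\<close>

lemma cis_taylor_bound:
  fixes u b :: real
  assumes "0 \<le> b" "b \<le> 1"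
  shows "cmod (cis u - (1 + \<i> * of_real u - of_real (u\<^sup>2 / 2))) \<le> \<bar>u\<bar> powr (2 + b)"
proof -
  have sum: "(\<Sum>k\<le>2. (\<i> * of_real u) ^ k / fact k) = 1 + \<i> * of_real u - of_real (u\<^sup>2 / 2)"
  proof -
    have "{..2::nat} = {0, 1, 2}"
      by auto
    then show ?thesis
      by (simp add: power_mult_distrib fact_numeral)
  qed
  have cis: "cis u = iexp u"
    by (simp add: cis_conv_exp)
  show ?thesis
  proof (cases "\<bar>u\<bar> \<le> 1")
    case True
    have "cmod (cis u - (1 + \<i> * of_real u - of_real (u\<^sup>2 / 2))) \<le> \<bar>u\<bar> ^ 3 / 6"
      using iexp_approx1[of u 2] unfolding sum cis
      by (simp add: fact_numeral flip: numeral_3_eq_3)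
    also have "\<dots> \<le> \<bar>u\<bar> ^ 3"
      by simp
    also have "\<dots> \<le> \<bar>u\<bar> powr (2 + b)"
    proof (cases "u = 0")
      case False
      have "\<bar>u\<bar> powr 3 \<le> \<bar>u\<bar> powr (2 + b)"
        using True False assms by (intro powr_mono') auto
      then show ?thesis using False by (simp add: powr_numeral)
    qed simp
    finally show ?thesis .
  next
    case False
    have "cmod (cis u - (1 + \<i> * of_real u - of_real (u\<^sup>2 / 2))) \<le> \<bar>u\<bar>\<^sup>2"
      using iexp_approx2[of u 2] unfolding sum cis by (simp add: fact_numeral)
    also have "\<dots> = \<bar>u\<bar> powr 2"
      using False by simp
    also have "\<dots> \<le> \<bar>u\<bar> powr (2 + b)"
      using False assms by (intro powr_mono) auto
    finally show ?thesis .
  qed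
qed

lemma has_moments_mono:
  assumes "finite_measure \<mu>" "sets \<mu> = sets borel" "has_moments q \<mu>" "0 \<le> p" "p \<le> q"
  shows "has_moments p \<mu>"
proof -
  interpret finite_measure \<mu> by fact
  note [measurable_cong] = assms(2)
  have le: "t powr p \<le> 1 + t powr q" if "0 \<le> t" for t :: real
  proof (cases "t \<le> 1")
    case True
    then have "t powr p \<le> 1" using that assms by (intro powr_le1) auto
    then show ?thesis by (simp add: add_increasing2)
  next
    case False
    then show ?thesis using assms powr_mono[of p q t] by (simp add: add_increasing)
  qed
  have "integrable \<mu> (\<lambda>x. 1 + norm x powr q)"
    using assms(3) by (simp add: has_moments_def)
  then show ?thesis
    unfolding has_moments_def
    by (rule Bochner_Integration.integrable_bound) (use le in \<open>simp_all add: add_nonneg_nonneg\<close>)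
qed

text \<open>A quadratic form attains its minimum on the unit sphere. A zero minimum at
  \<open>v\<close> would force \<open>v \<bullet> x = 0\<close> almost surely and confine
  \<open>\<mu>\<close> to a hyperplane, against full dimensionality. Homogeneity carries the
  positive minimum to every \<open>\<theta>\<close>.\<close>

lemma second_moment_coercive:
  fixes \<mu> :: "'a::euclidean_space measure"
  assumes "sets \<mu> = sets borel" "full_dimensional \<mu>" "integrable \<mu> (\<lambda>x. (norm x)\<^sup>2)"
  obtains a where "a > 0" "\<And>\<theta>. a * (norm \<theta>)\<^sup>2 \<le> (\<integral>x. (\<theta> \<bullet> x)\<^sup>2 \<partial>\<mu>)"
proof -
  note [measurable_cong] = assms(1)
  define q where "q = (\<lambda>\<theta>. \<integral>x. (\<theta> \<bullet> x)\<^sup>2 \<partial>\<mu>)"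
  have int: "integrable \<mu> (\<lambda>x. (x \<bullet> u) * (x \<bullet> v))" for u v
  proof (rule Bochner_Integration.integrable_bound)
    show "integrable \<mu> (\<lambda>x. norm u * norm v * (norm x)\<^sup>2)"
      using assms(3) by simp
    show "AE x in \<mu>. norm ((x \<bullet> u) * (x \<bullet> v)) \<le> norm (norm u * norm v * (norm x)\<^sup>2)"
    proof (rule AE_I2)
      fix x :: 'a
      have "\<bar>x \<bullet> u\<bar> * \<bar>x \<bullet> v\<bar> \<le> (norm x * norm u) * (norm x * norm v)"
        by (intro mult_mono Cauchy_Schwarz_ineq2) auto
      then show "norm ((x \<bullet> u) * (x \<bullet> v)) \<le> norm (norm u * norm v * (norm x)\<^sup>2)"
        by (simp add: abs_mult power2_eq_square mult_ac)
    qed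
  qed simp
  have int2: "integrable \<mu> (\<lambda>x. (\<theta> \<bullet> x)\<^sup>2)" for \<theta>
    using int[of \<theta> \<theta>] by (simp add: power2_eq_square inner_commute)
  \<comment> \<open>In coordinates \<open>q\<close> is a polynomial in \<open>\<theta>\<close> with
    the mixed second moments as coefficients, hence continuous.\<close>
  have "q \<theta> = (\<Sum>b\<in>Basis. \<Sum>c\<in>Basis. (\<theta> \<bullet> b) * (\<theta> \<bullet> c) * (\<integral>x. (x \<bullet> b) * (x \<bullet> c) \<partial>\<mu>))" for \<theta>
  proof -
    have "(\<theta> \<bullet> x)\<^sup>2 = (\<Sum>b\<in>Basis. \<Sum>c\<in>Basis. (\<theta> \<bullet> b) * (\<theta> \<bullet> c) * ((x \<bullet> b) * (x \<bullet> c)))" for x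
      unfolding power2_eq_square euclidean_inner[of \<theta> x] sum_product
      by (intro sum.cong refl) (simp add: mult_ac)
    then have "q \<theta> = (\<integral>x. (\<Sum>b\<in>Basis. \<Sum>c\<in>Basis. (\<theta> \<bullet> b) * (\<theta> \<bullet> c) * ((x \<bullet> b) * (x \<bullet> c))) \<partial>\<mu>)"
      by (simp add: q_def)
    then show ?thesis
      using int by simp
  qed
  then have "continuous_on (sphere 0 1) q"
    by (simp add: continuous_intros)
  moreover have "sphere (0::'a) 1 \<noteq> {}"
    using vector_choose_size[of 1] by (auto simp: sphere_def)
  ultimately obtain v where v: "v \<in> sphere 0 1" "\<And>w. w \<in> sphere 0 1 \<Longrightarrow> q v \<le> q w"
    using continuous_attains_inf[of "sphere 0 1" q] by (metis compact_sphere)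
  have "q v \<noteq> 0"
  proof
    assume "q v = 0"
    then have "AE x in \<mu>. (v \<bullet> x)\<^sup>2 = 0"
      unfolding q_def by (subst (asm) integral_nonneg_eq_0_iff_AE[OF int2]) auto
    then have "AE x in \<mu>. x \<in> {x. v \<bullet> x = 0}"
      by simp
    moreover have "subspace {x. v \<bullet> x = 0}"
      by (rule subspace_hyperplane)
    moreover have "v \<notin> {x. v \<bullet> x = 0}"
      using v(1) by auto
    ultimately show False
      using assms(2) unfolding full_dimensional_def by blast
  qed
  moreover have "q v \<ge> 0"
    by (simp add: q_def)
  ultimately have "q v > 0"
    by simp
  moreover have "q v * (norm \<theta>)\<^sup>2 \<le> q \<theta>" for \<theta>
  proof (cases "\<theta> = 0")
    case False
    have "q v \<le> q (\<theta> /\<^sub>R norm \<theta>)"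
      using False by (intro v(2)) simp
    also have "q (\<theta> /\<^sub>R norm \<theta>) = q \<theta> / (norm \<theta>)\<^sup>2"
      by (simp add: q_def power_mult_distrib power_inverse divide_inverse mult.commute)
    finally show ?thesis
      using False by (simp add: field_simps)
  qed (simp add: q_def)
  ultimately show thesis
    using that by (simp add: q_def)
qed

text \<open>With mean 0 the expansion is \<open>1 - q \<theta> / 2\<close> up to an error of order
  \<open>norm \<theta> powr (2 + b)\<close>, and \<open>q \<theta>\<close> is at least a multiple of
  \<open>(norm \<theta>)\<^sup>2\<close>. Near 0 the error consumes at most half of the quadratic
  loss, and \<open>1 + x \<le> exp x\<close> turns the rest into a Gaussian.\<close>

lemma char_fun_gaussian_bound:
  fixes \<mu> :: "'a::euclidean_space measure"
  assumes "prob_space \<mu>" and sets: "sets \<mu> = sets borel"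
    and "full_dimensional \<mu>" "mean_zero \<mu>" "has_moments (2 + \<beta>) \<mu>" "\<beta> > 0"
  obtains a \<delta> where "a > 0" "\<delta> > 0"
    "\<And>\<theta>. norm \<theta> \<le> \<delta> \<Longrightarrow> cmod (char_fun \<mu> \<theta>) \<le> exp (- a * (norm \<theta>)\<^sup>2)"
proof -
  interpret prob_space \<mu> by fact
  note [measurable_cong] = sets
  \<comment> \<open>The Taylor estimate allows exponents \<open>2 + b\<close> only up to 3.\<close>
  define b where "b = min \<beta> 1"
  have b: "0 < b" "b \<le> 1" "b \<le> \<beta>"
    using assms by (auto simp: b_def)
  have mb: "has_moments (2 + b) \<mu>" and m2: "has_moments 2 \<mu>"
    by (rule has_moments_mono[OF _ sets assms(5)]; use b in \<open>simp add: finite_measure_axioms\<close>)+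
  have norm2: "integrable \<mu> (\<lambda>x. (norm x)\<^sup>2)"
    using m2 by (simp add: has_moments_def)
  obtain a where a: "a > 0" "\<And>\<theta>. a * (norm \<theta>)\<^sup>2 \<le> (\<integral>x. (\<theta> \<bullet> x)\<^sup>2 \<partial>\<mu>)"
    using second_moment_coercive[OF sets assms(3) norm2] by metis
  define q where "q = (\<lambda>\<theta>. \<integral>x. (\<theta> \<bullet> x)\<^sup>2 \<partial>\<mu>)"
  define m where "m = (\<integral>x. norm x powr (2 + b) \<partial>\<mu>)"
  define s where "s = (\<integral>x. (norm x)\<^sup>2 \<partial>\<mu>)"
  have m: "m \<ge> 0" and s: "s \<ge> 0"
    by (simp_all add: m_def s_def)
  have pw: "(\<theta> \<bullet> x)\<^sup>2 \<le> (norm \<theta>)\<^sup>2 * (norm x)\<^sup>2" for \<theta> x :: 'a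
    using power_mono[OF Cauchy_Schwarz_ineq2[of \<theta> x], of 2] by (simp add: power_mult_distrib)
  have int2: "integrable \<mu> (\<lambda>x. (\<theta> \<bullet> x)\<^sup>2)" for \<theta>
    by (rule Bochner_Integration.integrable_bound[of _ "\<lambda>x. (norm \<theta>)\<^sup>2 * (norm x)\<^sup>2"])
       (use norm2 pw in auto)
  have q_le: "q \<theta> \<le> (norm \<theta>)\<^sup>2 * s" for \<theta>
    unfolding q_def s_def integral_mult_right_zero[symmetric]
    using pw by (intro integral_mono int2) (use norm2 in auto)
  have err: "cmod (char_fun \<mu> \<theta> - of_real (1 - q \<theta> / 2)) \<le> norm \<theta> powr (2 + b) * m" for \<theta>
  proof -
    have i1: "integrable \<mu> (\<lambda>x. cis (\<theta> \<bullet> x))"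
      by (rule integrable_const_bound[where B=1]) auto
    have i3: "integrable \<mu> (\<lambda>x. norm \<theta> powr (2 + b) * norm x powr (2 + b))"
      using mb by (simp add: has_moments_def)
    \<comment> \<open>Mean 0 enters here: the linear term integrates to
      \<open>\<i> * (\<theta> \<bullet> 0)\<close>, which vanishes.\<close>
    have lin: "has_bochner_integral \<mu> (\<lambda>x. \<i> * complex_of_real (\<theta> \<bullet> x)) (\<i> * of_real (\<theta> \<bullet> 0))"
      using assms(4) unfolding mean_zero_def
      by (intro has_bochner_integral_mult_right has_bochner_integral_of_real
          has_bochner_integral_inner_right)
    have quad: "has_bochner_integral \<mu> (\<lambda>x. complex_of_real ((\<theta> \<bullet> x)\<^sup>2 / 2)) (of_real (q \<theta> / 2))"
      using int2[of \<theta>]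
      by (intro has_bochner_integral_of_real has_bochner_integral_divide)
         (simp_all add: has_bochner_integral_iff q_def)
    have one: "has_bochner_integral \<mu> (\<lambda>x. 1 :: complex) 1"
      by (simp add: has_bochner_integral_iff prob_space)
    have "has_bochner_integral \<mu> (\<lambda>x. 1 + \<i> * of_real (\<theta> \<bullet> x) - of_real ((\<theta> \<bullet> x)\<^sup>2 / 2))
        (1 + \<i> * of_real (\<theta> \<bullet> 0) - of_real (q \<theta> / 2))"
      by (intro has_bochner_integral_diff has_bochner_integral_add one lin quad)
    then have i2: "integrable \<mu> (\<lambda>x. 1 + \<i> * of_real (\<theta> \<bullet> x) - of_real ((\<theta> \<bullet> x)\<^sup>2 / 2))"
      and "(\<integral>x. 1 + \<i> * of_real (\<theta> \<bullet> x) - of_real ((\<theta> \<bullet> x)\<^sup>2 / 2) \<partial>\<mu>) = of_real (1 - q \<theta> / 2)"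
      unfolding has_bochner_integral_iff by auto
    then have eq: "char_fun \<mu> \<theta> - of_real (1 - q \<theta> / 2)
       = (\<integral>x. cis (\<theta> \<bullet> x) - (1 + \<i> * of_real (\<theta> \<bullet> x) - of_real ((\<theta> \<bullet> x)\<^sup>2 / 2)) \<partial>\<mu>)"
      by (subst Bochner_Integration.integral_diff[OF i1 i2]) (simp only: char_fun_def)
    have pt: "cmod (cis (\<theta> \<bullet> x) - (1 + \<i> * of_real (\<theta> \<bullet> x) - of_real ((\<theta> \<bullet> x)\<^sup>2 / 2)))
        \<le> norm \<theta> powr (2 + b) * norm x powr (2 + b)" for x
    proof -
      have "\<bar>\<theta> \<bullet> x\<bar> powr (2 + b) \<le> (norm \<theta> * norm x) powr (2 + b)"
        using b by (intro powr_mono2 Cauchy_Schwarz_ineq2) auto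
      then show ?thesis
        using cis_taylor_bound[of b "\<theta> \<bullet> x"] b by (simp add: powr_mult)
    qed
    show ?thesis
      unfolding eq m_def integral_mult_right_zero[symmetric]
      by (rule order_trans[OF Bochner_Integration.integral_norm_bound])
         (intro integral_mono integrable_norm Bochner_Integration.integrable_diff i1 i2 i3 pt)
  qed
  \<comment> \<open>The first two bounds give \<open>q \<theta> \<le> 1\<close>, so that
    \<open>1 - q \<theta> / 2\<close> is its own absolute value. The third makes
    \<open>norm \<theta> powr b * m\<close> at most \<open>a / 4\<close>. Adding 1 to
    \<open>s\<close> and \<open>m\<close> keeps the denominators positive.\<close>
  define \<delta> where "\<delta> = min (1 / (s + 1)) (min 1 ((a / (4 * (m + 1))) powr (1 / b)))"
  have "\<delta> > 0"
    using a m s by (simp add: \<delta>_def)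
  moreover have "cmod (char_fun \<mu> \<theta>) \<le> exp (- (a / 4) * (norm \<theta>)\<^sup>2)" if \<theta>: "norm \<theta> \<le> \<delta>" for \<theta>
  proof -
    let ?t = "norm \<theta>"
    have "?t\<^sup>2 \<le> ?t * 1"
      unfolding power2_eq_square using \<theta> by (intro mult_left_mono) (auto simp: \<delta>_def)
    then have "?t\<^sup>2 * s \<le> ?t * s"
      using s by (intro mult_right_mono) auto
    also have "\<dots> \<le> (1 / (s + 1)) * s"
      using s \<theta> by (intro mult_right_mono) (auto simp: \<delta>_def)
    also have "\<dots> \<le> 1"
      using s by (simp add: field_simps)
    finally have q1: "q \<theta> \<le> 1"
      using q_le[of \<theta>] by simp
    have "?t powr b \<le> ((a / (4 * (m + 1))) powr (1 / b)) powr b"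
      using \<theta> b by (intro powr_mono2) (auto simp: \<delta>_def)
    also have "\<dots> = a / (4 * (m + 1))"
      using a m b by (simp add: powr_powr)
    finally have "?t powr b * (m + 1) \<le> a / 4"
      using m by (simp add: field_simps)
    moreover have "?t powr b * m \<le> ?t powr b * (m + 1)"
      by (intro mult_left_mono) auto
    ultimately have tb: "?t powr b * m \<le> a / 4"
      by simp
    have "?t powr (2 + b) * m = ?t\<^sup>2 * (?t powr b * m)"
      by (cases "\<theta> = 0") (auto simp: powr_add)
    also have "\<dots> \<le> ?t\<^sup>2 * (a / 4)"
      using tb by (intro mult_left_mono) auto
    finally have e: "cmod (char_fun \<mu> \<theta> - of_real (1 - q \<theta> / 2)) \<le> ?t\<^sup>2 * (a / 4)"
      using err[of \<theta>] by simp
    have "cmod (char_fun \<mu> \<theta>) \<le> cmod (char_fun \<mu> \<theta> - of_real (1 - q \<theta> / 2)) + cmod (of_real (1 - q \<theta> / 2))"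
      using norm_triangle_ineq[of "char_fun \<mu> \<theta> - of_real (1 - q \<theta> / 2)" "of_real (1 - q \<theta> / 2)"]
      by simp
    also have "\<dots> \<le> ?t\<^sup>2 * (a / 4) + (1 - a * ?t\<^sup>2 / 2)"
      using e a(2)[of \<theta>] q1 by (intro add_mono) (auto simp only: norm_of_real q_def)
    also have "\<dots> = 1 + (- (a / 4) * ?t\<^sup>2)"
      by (simp add: field_simps)
    also have "\<dots> \<le> exp (- (a / 4) * ?t\<^sup>2)"
      by (rule exp_ge_add_one_self)
    finally show ?thesis .
  qed
  ultimately show thesis
    using that[of "a / 4" \<delta>] a by simp
qed

section \<open>The Gaussian integral and the law \<open>W\<close> with nonnegative transform\<close>

lemma nn_integral_gaussian:
  assumes "c > 0"
  shows "(\<integral>\<^sup>+\<theta>. ennreal (exp (- c * (norm \<theta>)\<^sup>2)) \<partial>(lborel :: 'a::euclidean_space measure))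
    = ennreal (sqrt (pi / c) ^ DIM('a))"
proof -
  \<comment> \<open>With this \<open>\<sigma>\<close>, \<open>exp (- c * x\<^sup>2)\<close> is a
    multiple of a centred normal density, whose integral is 1.\<close>
  define \<sigma> where "\<sigma> = sqrt (1 / (2 * c))"
  have "\<sigma> > 0" and \<sigma>: "\<sigma>\<^sup>2 = 1 / (2 * c)"
    using assms by (simp_all add: \<sigma>_def)
  have "exp (- c * x\<^sup>2) = sqrt (pi / c) * normal_density 0 \<sigma> x" for x
    using assms by (simp add: normal_density_def \<sigma> real_sqrt_divide)
  then have one: "(\<integral>\<^sup>+x. ennreal (exp (- c * x\<^sup>2)) \<partial>lborel) = ennreal (sqrt (pi / c))"
    using \<open>\<sigma> > 0\<close> assms by (simp only:) (subst nn_integral_eq_integral, auto)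
  have "(\<integral>\<^sup>+\<theta>. ennreal (exp (- c * (norm \<theta>)\<^sup>2)) \<partial>(lborel :: 'a measure))
      = (\<integral>\<^sup>+\<theta>. (\<Prod>b\<in>Basis. ennreal (exp (- c * (\<theta> \<bullet> b)\<^sup>2))) \<partial>(lborel :: 'a measure))"
  proof (rule nn_integral_cong)
    fix \<theta> :: 'a
    have "(norm \<theta>)\<^sup>2 = (\<Sum>b\<in>Basis. (\<theta> \<bullet> b)\<^sup>2)"
      by (simp add: norm_eq_sqrt_inner euclidean_inner[of \<theta> \<theta>] power2_eq_square sum_nonneg)
    then show "ennreal (exp (- c * (norm \<theta>)\<^sup>2)) = (\<Prod>b\<in>Basis. ennreal (exp (- c * (\<theta> \<bullet> b)\<^sup>2)))"
      by (simp add: prod_ennreal exp_sum[symmetric] sum_distrib_left sum_negf)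
  qed
  also have "\<dots> = (\<Prod>b\<in>(Basis :: 'a set). \<integral>\<^sup>+x. ennreal (exp (- c * x\<^sup>2)) \<partial>lborel)"
    by (rule nn_integral_lborel_prod) auto
  also have "\<dots> = ennreal (sqrt (pi / c) ^ DIM('a))"
    using assms by (simp only: one) (simp add: ennreal_power)
  finally show ?thesis .
qed

text \<open>\<open>W\<close> is the law of \<open>a - b\<close> for independent \<open>a\<close>,
  \<open>b\<close> uniform on the ball of radius \<open>r\<close>. Its transform is the squared
  modulus of that of \<open>U\<close>; hence the sign, and 1/4 as the square of 1/2. Given
  \<open>a\<close>, the difference is uniform on a translate of the ball, so the density of
  \<open>W\<close> never exceeds the reciprocal of the volume of the ball.\<close>

lemma ex_positive_definite_weight:
  assumes "r > 0"
  obtains W :: "'a::euclidean_space measure" where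
    "prob_space W" "sets W = sets borel" "AE \<theta> in W. norm \<theta> \<le> 2 * r"
    "\<And>h. h \<in> borel_measurable borel \<Longrightarrow>
       (\<integral>\<^sup>+\<theta>. h \<theta> \<partial>W) \<le> (\<integral>\<^sup>+\<theta>. h \<theta> \<partial>lborel) / emeasure lborel (cball (0::'a) r)"
    "\<And>x. char_fun W x \<in> \<real>\<^sub>\<ge>\<^sub>0"
    "\<And>x. r * norm x \<le> 1 \<Longrightarrow> 1 / 4 \<le> Re (char_fun W x)"
proof
  define U where "U = uniform_measure lborel (cball (0::'a) r)"
  define W where "W = distr (U \<Otimes>\<^sub>M U) borel (\<lambda>(a, b). a - b)"
  have e: "emeasure lborel (cball (0::'a) r) \<noteq> 0" "emeasure lborel (cball (0::'a) r) < \<infinity>"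
    using assms emeasure_lborel_cball_finite[of "0::'a" r]
    by (auto simp: emeasure_cball unit_ball_vol_pos[THEN less_imp_neq, symmetric])
  interpret U: prob_space U
    unfolding U_def using e by (intro prob_space_uniform_measure) auto
  interpret UU: pair_prob_space U U ..
  have [measurable_cong]: "sets U = sets borel"
    by (simp add: U_def)
  show "prob_space W"
    unfolding W_def by (intro UU.prob_space_distr) simp
  show "sets W = sets borel"
    by (simp add: W_def)
  have ballU: "AE \<theta> in U. norm \<theta> \<le> r"
    unfolding U_def by (rule AE_uniform_measureI) auto
  have "AE a in U. AE b in U. norm (a - b) \<le> 2 * r"
    using ballU
  proof eventually_elim
    case (elim a)
    from ballU show ?case
    proof eventually_elim
      case (elim b)
      then show ?case
        using norm_triangle_ineq4[of a b] \<open>norm a \<le> r\<close> by simp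
    qed
  qed
  then have "AE p in U \<Otimes>\<^sub>M U. norm (fst p - snd p) \<le> 2 * r"
    by (intro UU.AE_pair_measure) auto
  then show "AE \<theta> in W. norm \<theta> \<le> 2 * r"
    unfolding W_def by (subst AE_distr_iff) (auto simp: case_prod_beta)
  show "(\<integral>\<^sup>+\<theta>. h \<theta> \<partial>W) \<le> (\<integral>\<^sup>+\<theta>. h \<theta> \<partial>lborel) / emeasure lborel (cball (0::'a) r)"
    if [measurable]: "h \<in> borel_measurable borel" for h
  proof -
    have "(\<integral>\<^sup>+\<theta>. h \<theta> \<partial>W) = (\<integral>\<^sup>+a. \<integral>\<^sup>+b. h (a - b) \<partial>U \<partial>U)"
      unfolding W_def by (subst nn_integral_distr) (auto simp: U.nn_integral_fst[symmetric])
    also have "\<dots> \<le> (\<integral>\<^sup>+a. (\<integral>\<^sup>+\<theta>. h \<theta> \<partial>lborel) / emeasure lborel (cball (0::'a) r) \<partial>U)"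
    proof (rule nn_integral_mono)
      fix a :: 'a
      \<comment> \<open>The map \<open>b \<mapsto> a - b\<close> preserves Lebesgue measure;
        dropping the indicator of the ball then gives a bound that does not depend on
        \<open>a\<close>.\<close>
      have "(\<integral>\<^sup>+\<theta>. h \<theta> \<partial>lborel) = (\<integral>\<^sup>+b. h (a - b) \<partial>lborel)"
        by (subst lborel_affine[of "-1" a]) (simp_all add: nn_integral_density nn_integral_distr)
      moreover have "(\<integral>\<^sup>+b. h (a - b) * indicator (cball 0 r) b \<partial>lborel) \<le> (\<integral>\<^sup>+b. h (a - b) \<partial>lborel)"
        by (intro nn_integral_mono) (simp add: indicator_def)
      ultimately show "(\<integral>\<^sup>+b. h (a - b) \<partial>U)
          \<le> (\<integral>\<^sup>+\<theta>. h \<theta> \<partial>lborel) / emeasure lborel (cball (0::'a) r)"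
        unfolding U_def by (subst nn_integral_uniform_measure) (auto intro!: divide_right_mono_ennreal)
    qed
    also have "\<dots> = (\<integral>\<^sup>+\<theta>. h \<theta> \<partial>lborel) / emeasure lborel (cball (0::'a) r)"
      by (simp add: U.emeasure_space_1)
    finally show ?thesis .
  qed
  have sq: "char_fun W x = of_real ((cmod (char_fun U x))\<^sup>2)" for x
  proof -
    have "char_fun W x = (\<integral>p. cis (x \<bullet> (fst p - snd p)) \<partial>(U \<Otimes>\<^sub>M U))"
      unfolding W_def char_fun_def by (subst integral_distr) (auto simp: case_prod_beta)
    also have "\<dots> = (\<integral>a. \<integral>b. cis (x \<bullet> (a - b)) \<partial>U \<partial>U)"
      by (subst UU.integral_fst'[symmetric]) (auto intro!: UU.P.integrable_const_bound[where B=1])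
    also have "\<dots> = (\<integral>a. \<integral>b. cis (x \<bullet> a) * cnj (cis (x \<bullet> b)) \<partial>U \<partial>U)"
      by (simp add: inner_diff_right cis_cnj cis_mult)
    also have "\<dots> = char_fun U x * cnj (char_fun U x)"
      unfolding char_fun_def by (simp del: cis_cnj)
    finally show ?thesis
      by (simp only: complex_norm_square)
  qed
  then show "char_fun W x \<in> \<real>\<^sub>\<ge>\<^sub>0" for x
    by simp
  show "1 / 4 \<le> Re (char_fun W x)" if "r * norm x \<le> 1" for x
  proof -
    have int: "integrable U (\<lambda>\<theta>. cis (x \<bullet> \<theta>))"
      by (rule U.integrable_const_bound[where B=1]) auto
    have "1 / 2 = (\<integral>\<theta>. (1 / 2 :: real) \<partial>U)"
      by (simp add: U.prob_space)
    also have "\<dots> \<le> (\<integral>\<theta>. Re (cis (x \<bullet> \<theta>)) \<partial>U)"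
    proof (rule integral_mono_AE)
      show "AE \<theta> in U. 1 / 2 \<le> Re (cis (x \<bullet> \<theta>))"
        using ballU
      proof eventually_elim
        case (elim \<theta>)
        have "\<bar>x \<bullet> \<theta>\<bar> \<le> norm x * r"
          using Cauchy_Schwarz_ineq2[of x \<theta>] elim mult_left_mono[of "norm \<theta>" r "norm x"] by simp
        \<comment> \<open>\<open>r * norm x \<le> 1\<close> and \<open>1 < pi / 3\<close> bring the
          angle into the range where the cosine is at least 1/2.\<close>
        then have "\<bar>x \<bullet> \<theta>\<bar> \<le> pi / 3"
          using that pi_gt3 by (simp add: mult.commute)
        then have "cos (pi / 3) \<le> cos \<bar>x \<bullet> \<theta>\<bar>"
          by (intro cos_monotone_0_pi_le) auto
        then show ?case
          by (simp add: cos_60)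
      qed
    qed (auto intro!: U.integrable_const_bound[where B=1])
    also have "\<dots> = Re (char_fun U x)"
      unfolding char_fun_def by (rule integral_Re[OF int])
    also have "\<dots> \<le> cmod (char_fun U x)"
      by (rule complex_Re_le_cmod)
    finally have "(1 / 2)\<^sup>2 \<le> (cmod (char_fun U x))\<^sup>2"
      by (intro power_mono) auto
    then show ?thesis
      by (simp add: sq power2_eq_square)
  qed
qed

section \<open>Integration against a step independent of the past\<close>

lemma borel_measurable_power_nat [measurable]:
  fixes f :: "'b \<Rightarrow> complex"
  assumes [measurable]: "f \<in> borel_measurable M" and N: "N \<in> measurable M (count_space (UNIV :: nat set))"
  shows "(\<lambda>x. f x ^ N x) \<in> borel_measurable M"
  by (rule measurable_compose_countable[OF _ N]) simp

text \<open>This is conditioning on \<open>G\<close> in its frozen-variable form: independence makes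
  the joint law of \<open>(\<omega>, X \<omega>)\<close> a product, and Tonelli integrates out
  \<open>X\<close> first with \<open>\<omega>\<close> held fixed.\<close>

lemma (in prob_space) nn_integral_indep_subalgebra:
  assumes G: "subalgebra M G" and X [measurable]: "X \<in> measurable M N"
    and indep: "\<And>A B. A \<in> sets G \<Longrightarrow> B \<in> sets N \<Longrightarrow>
      prob (A \<inter> (X -` B \<inter> space M)) = prob A * prob (X -` B \<inter> space M)"
    and H [measurable]: "(\<lambda>(\<omega>, y). H \<omega> y) \<in> borel_measurable (G \<Otimes>\<^sub>M N)"
  shows "(\<integral>\<^sup>+\<omega>. H \<omega> (X \<omega>) \<partial>M) = (\<integral>\<^sup>+\<omega>. \<integral>\<^sup>+y. H \<omega> y \<partial>distr M N X \<partial>M)"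
proof -
  have id [measurable]: "(\<lambda>\<omega>. \<omega>) \<in> measurable M G"
    using G by (rule measurable_from_subalg) simp
  have space: "space G = space M"
    using G by (simp add: subalgebra_def)
  interpret X: prob_space "distr M N X"
    by (rule prob_space_distr) fact
  \<comment> \<open>\<open>distr M G (\<lambda>\<omega>. \<omega>)\<close> is the restriction of
    \<open>M\<close> to \<open>G\<close>; independence is given only for events of this smaller
    sigma-algebra.\<close>
  interpret G: prob_space "distr M G (\<lambda>\<omega>. \<omega>)"
    by (rule prob_space_distr) fact
  have eq: "distr M G (\<lambda>\<omega>. \<omega>) \<Otimes>\<^sub>M distr M N X = distr M (G \<Otimes>\<^sub>M N) (\<lambda>\<omega>. (\<omega>, X \<omega>))"
  proof (rule pair_measure_eqI)
    fix A B assume "A \<in> sets (distr M G (\<lambda>\<omega>. \<omega>))" "B \<in> sets (distr M N X)"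
    then have A: "A \<in> sets G" and B: "B \<in> sets N"
      by auto
    have AM: "A \<inter> space M = A"
      using sets.sets_into_space[OF A] space by auto
    have AB: "(\<lambda>\<omega>. (\<omega>, X \<omega>)) -` (A \<times> B) \<inter> space M = A \<inter> (X -` B \<inter> space M)"
      using sets.sets_into_space[OF A] space by auto
    show "emeasure (distr M G (\<lambda>\<omega>. \<omega>)) A * emeasure (distr M N X) B
        = emeasure (distr M (G \<Otimes>\<^sub>M N) (\<lambda>\<omega>. (\<omega>, X \<omega>))) (A \<times> B)"
      using A B indep[OF A B]
      by (simp add: emeasure_distr AM AB emeasure_eq_measure ennreal_mult)
  qed (auto intro: G.sigma_finite_measure_axioms X.sigma_finite_measure_axioms)
  have H': "(\<lambda>(\<omega>, y). H \<omega> y) \<in> borel_measurable (distr M G (\<lambda>\<omega>. \<omega>) \<Otimes>\<^sub>M distr M N X)"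
    by simp
  have meas: "(\<lambda>\<omega>. \<integral>\<^sup>+y. H \<omega> y \<partial>distr M N X) \<in> borel_measurable G"
    by (rule X.borel_measurable_nn_integral) simp
  have "(\<integral>\<^sup>+\<omega>. H \<omega> (X \<omega>) \<partial>M) = (\<integral>\<^sup>+p. (\<lambda>(\<omega>, y). H \<omega> y) p \<partial>distr M (G \<Otimes>\<^sub>M N) (\<lambda>\<omega>. (\<omega>, X \<omega>)))"
    by (subst nn_integral_distr) simp_all
  also have "\<dots> = (\<integral>\<^sup>+\<omega>. \<integral>\<^sup>+y. H \<omega> y \<partial>distr M N X \<partial>distr M G (\<lambda>\<omega>. \<omega>))"
    unfolding eq[symmetric] by (subst X.nn_integral_fst[OF H', symmetric]) simp
  also have "\<dots> = (\<integral>\<^sup>+\<omega>. \<integral>\<^sup>+y. H \<omega> y \<partial>distr M N X \<partial>M)"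
    using meas by (subst nn_integral_distr) simp_all
  finally show ?thesis .
qed

section \<open>The potential for prescribed step counts\<close>

locale weighted_steps =
  fixes W :: "'a::euclidean_space measure" and J :: "nat set" and \<mu> :: "nat \<Rightarrow> 'a measure"
  assumes prob_W: "prob_space W" and sets_W [measurable_cong]: "sets W = sets borel"
    and char_W: "char_fun W x \<in> \<real>\<^sub>\<ge>\<^sub>0"
    and finite_J: "finite J"
    and prob_\<mu>: "j \<in> J \<Longrightarrow> prob_space (\<mu> j)" and sets_\<mu>: "j \<in> J \<Longrightarrow> sets (\<mu> j) = sets borel"
begin

sublocale W: prob_space W
  by (rule prob_W)

lemma borel_measurable_char_fun [measurable]:
  assumes "j \<in> J"
  shows "char_fun (\<mu> j) \<in> borel_measurable borel"
proof -
  interpret prob_space "\<mu> j" using assms by (rule prob_\<mu>)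
  note [measurable_cong] = sets_\<mu>[OF assms]
  show ?thesis
    unfolding char_fun_def by measurable
qed

lemma norm_char_fun_le_1:
  assumes "j \<in> J"
  shows "cmod (char_fun (\<mu> j) \<theta>) \<le> 1"
proof -
  interpret prob_space "\<mu> j" using assms by (rule prob_\<mu>)
  have "cmod (char_fun (\<mu> j) \<theta>) \<le> (\<integral>x. cmod (cis (\<theta> \<bullet> x)) \<partial>\<mu> j)"
    unfolding char_fun_def by (rule Bochner_Integration.integral_norm_bound)
  then show ?thesis
    by (simp add: prob_space)
qed

text \<open>
  This is the expectation of \<open>char_fun W\<close> at \<open>x\<close> plus the sum of independent steps, \<open>n j\<close> of them with
  law \<open>\<mu> j\<close>; the Fourier form makes it evident that the steps may be removed in any order.
\<close>
definition potential :: "(nat \<Rightarrow> nat) \<Rightarrow> 'a \<Rightarrow> complex" where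
  "potential n x = (\<integral>\<theta>. cis (\<theta> \<bullet> x) * (\<Prod>j\<in>J. char_fun (\<mu> j) \<theta> ^ n j) \<partial>W)"

lemma potential_eq_char_fun: "(\<And>j. j \<in> J \<Longrightarrow> n j = 0) \<Longrightarrow> potential n x = char_fun W x"
  by (simp add: potential_def char_fun_def inner_commute)

lemma norm_prod_char_fun_le_1: "cmod (\<Prod>j\<in>J. char_fun (\<mu> j) \<theta> ^ n j) \<le> 1"
  unfolding prod_norm[symmetric] norm_power
  by (intro prod_le_1 conjI zero_le_power power_le_one norm_ge_zero norm_char_fun_le_1)

lemma norm_integrand_le_1: "cmod (cis (\<theta> \<bullet> x) * (\<Prod>j\<in>J. char_fun (\<mu> j) \<theta> ^ n j)) \<le> 1"
  using norm_prod_char_fun_le_1 by (simp add: norm_mult)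

lemma borel_measurable_potential [measurable]:
  assumes [measurable]: "\<And>j. j \<in> J \<Longrightarrow> (\<lambda>\<omega>. N \<omega> j) \<in> measurable M (count_space UNIV)"
    and [measurable]: "X \<in> borel_measurable M"
  shows "(\<lambda>\<omega>. potential (N \<omega>) (X \<omega>)) \<in> borel_measurable M"
  unfolding potential_def by measurable

lemma norm_potential_le_1: "cmod (potential n x) \<le> 1"
proof -
  have "cmod (potential n x) \<le> (\<integral>\<theta>. cmod (cis (\<theta> \<bullet> x) * (\<Prod>j\<in>J. char_fun (\<mu> j) \<theta> ^ n j)) \<partial>W)"
    unfolding potential_def by (rule Bochner_Integration.integral_norm_bound)
  also have "\<dots> \<le> (\<integral>\<theta>. 1 \<partial>W)"
    by (intro integral_mono W.integrable_const_bound[where B=1]) (auto simp: norm_integrand_le_1)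
  finally show ?thesis
    by (simp add: W.prob_space)
qed

text \<open>Fubini moves the average over \<open>y\<close> inside the integral over
  \<open>\<theta>\<close>, where \<open>cis (\<theta> \<bullet> y)\<close> averages to
  \<open>char_fun (\<mu> j) \<theta>\<close>: one more factor in the product, that is, one more step
  of law \<open>\<mu> j\<close>.\<close>

lemma potential_step:
  assumes j: "j \<in> J"
  shows "integrable (\<mu> j) (\<lambda>y. potential n (x + y))"
    and "(\<integral>y. potential n (x + y) \<partial>\<mu> j) = potential (n(j := Suc (n j))) x"
proof -
  interpret \<mu>: prob_space "\<mu> j" using j by (rule prob_\<mu>)
  interpret P: pair_prob_space W "\<mu> j" ..
  note [measurable_cong] = sets_\<mu>[OF j]
  let ?f = "\<lambda>\<theta> y. cis (\<theta> \<bullet> (x + y)) * (\<Prod>i\<in>J. char_fun (\<mu> i) \<theta> ^ n i)"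
  show "integrable (\<mu> j) (\<lambda>y. potential n (x + y))"
    by (rule \<mu>.integrable_const_bound[where B=1]) (auto simp: norm_potential_le_1)
  have "integrable (W \<Otimes>\<^sub>M \<mu> j) (\<lambda>(\<theta>, y). ?f \<theta> y)"
  proof (rule P.P.integrable_const_bound[where B=1])
    show "AE p in W \<Otimes>\<^sub>M \<mu> j. cmod (case p of (\<theta>, y) \<Rightarrow> ?f \<theta> y) \<le> 1"
      using norm_integrand_le_1 by (auto simp: case_prod_beta)
  qed measurable
  then have "(\<integral>y. potential n (x + y) \<partial>\<mu> j) = (\<integral>\<theta>. \<integral>y. ?f \<theta> y \<partial>\<mu> j \<partial>W)"
    unfolding potential_def by (rule P.Fubini_integral)
  also have "\<dots> = (\<integral>\<theta>. cis (\<theta> \<bullet> x) * (\<Prod>i\<in>J. char_fun (\<mu> i) \<theta> ^ n i) * char_fun (\<mu> j) \<theta> \<partial>W)"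
  proof (intro Bochner_Integration.integral_cong refl)
    fix \<theta> :: 'a
    have "(\<integral>y. ?f \<theta> y \<partial>\<mu> j)
        = (\<integral>y. cis (\<theta> \<bullet> x) * (\<Prod>i\<in>J. char_fun (\<mu> i) \<theta> ^ n i) * cis (\<theta> \<bullet> y) \<partial>\<mu> j)"
      by (simp add: inner_add_right mult_ac flip: cis_mult)
    then show "(\<integral>y. ?f \<theta> y \<partial>\<mu> j)
        = cis (\<theta> \<bullet> x) * (\<Prod>i\<in>J. char_fun (\<mu> i) \<theta> ^ n i) * char_fun (\<mu> j) \<theta>"
      by (simp add: char_fun_def)
  qed
  also have "\<dots> = potential (n(j := Suc (n j))) x"
    unfolding potential_def
    by (simp add: prod.remove[OF finite_J j] mult_ac)
  finally show "(\<integral>y. potential n (x + y) \<partial>\<mu> j) = potential (n(j := Suc (n j))) x" .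
qed

text \<open>Nonnegativity starts from \<open>char_fun W\<close> and survives averaging: a potential
  with steps left is, by \<open>potential_step\<close>, the mean of one with a step fewer. The
  Fourier formula itself does not show the sign, as the factors
  \<open>char_fun (\<mu> j) \<theta>\<close> are complex.\<close>

lemma potential_nonneg: "potential n x \<in> \<real>\<^sub>\<ge>\<^sub>0"
proof (induction "\<Sum>j\<in>J. n j" arbitrary: n x)
  case 0
  then show ?case
    using finite_J char_W by (simp add: potential_eq_char_fun)
next
  case (Suc s)
  then obtain j where j: "j \<in> J" "n j \<noteq> 0"
    by (metis Zero_not_Suc sum.neutral)
  define n' where "n' = n(j := n j - 1)"
  have n: "n = n'(j := Suc (n' j))"
    using j by (auto simp: n'_def)
  have "s = (\<Sum>j\<in>J. n' j)"
    using Suc(2) j sum.remove[OF finite_J j(1), of n] sum.remove[OF finite_J j(1), of n']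
    by (simp add: n'_def)
  then have IH: "potential n' y \<in> \<real>\<^sub>\<ge>\<^sub>0" for y
    by (rule Suc(1))
  have "potential n' y = of_real (Re (potential n' y))" for y
    using IH[of y] by (simp add: complex_nonneg_Reals_iff complex_eq_iff)
  then have "potential n x = (\<integral>y. of_real (Re (potential n' (x + y))) \<partial>\<mu> j)"
    unfolding n potential_step(2)[OF j(1), of n' x, symmetric]
    by (intro Bochner_Integration.integral_cong refl)
  also have "\<dots> = of_real (\<integral>y. Re (potential n' (x + y)) \<partial>\<mu> j)"
    by simp
  also have "\<dots> \<in> \<real>\<^sub>\<ge>\<^sub>0"
    using IH by (auto simp: complex_nonneg_Reals_iff intro!: integral_nonneg)
  finally show ?case .
qed

lemma nn_integral_potential_step:
  assumes j: "j \<in> J"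
  shows "(\<integral>\<^sup>+y. ennreal (Re (potential n (x + y))) \<partial>\<mu> j) = ennreal (Re (potential (n(j := Suc (n j))) x))"
proof -
  have "(\<integral>\<^sup>+y. ennreal (Re (potential n (x + y))) \<partial>\<mu> j) = ennreal (\<integral>y. Re (potential n (x + y)) \<partial>\<mu> j)"
    using potential_step(1)[OF j] potential_nonneg
    by (intro nn_integral_eq_integral) (auto simp: complex_nonneg_Reals_iff)
  also have "(\<integral>y. Re (potential n (x + y)) \<partial>\<mu> j) = Re (potential (n(j := Suc (n j))) x)"
    using potential_step[OF j] by simp
  finally show ?thesis .
qed

text \<open>Here \<open>m\<close> counts the steps already made; the value is \<open>0\<close> once they exceed \<open>n\<close>.\<close>
definition bounded_potential :: "(nat \<Rightarrow> nat) \<Rightarrow> (nat \<Rightarrow> nat) \<Rightarrow> 'a \<Rightarrow> ennreal" where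
  "bounded_potential n m x =
     (if \<forall>j\<in>J. m j \<le> n j then ennreal (Re (potential (\<lambda>j. n j - m j) x)) else 0)"

lemma borel_measurable_bounded_potential [measurable]:
  assumes [measurable]: "\<And>j. j \<in> J \<Longrightarrow> (\<lambda>\<omega>. N \<omega> j) \<in> measurable M (count_space UNIV)"
    and [measurable]: "X \<in> borel_measurable M"
  shows "(\<lambda>\<omega>. bounded_potential n (N \<omega>) (X \<omega>)) \<in> borel_measurable M"
  unfolding bounded_potential_def using finite_J[THEN countable_finite] by measurable

text \<open>If the step keeps the counts within \<open>n\<close>, it uses up one of the prescribed
  steps and equality holds by \<open>nn_integral_potential_step\<close>. If it exceeds them, the
  left side is 0; only this case can make the inequality strict.\<close>

lemma nn_integral_bounded_potential_step:
  assumes j: "j \<in> J"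
  shows "(\<integral>\<^sup>+y. bounded_potential n (m(j := Suc (m j))) (x + y) \<partial>\<mu> j) \<le> bounded_potential n m x"
proof (cases "\<forall>i\<in>J. (m(j := Suc (m j))) i \<le> n i")
  case True
  define n' where "n' = (\<lambda>i. n i - (m(j := Suc (m j))) i)"
  have le: "\<forall>i\<in>J. m i \<le> n i"
    using True by (auto split: if_splits dest: Suc_leD)
  have "Suc (m j) \<le> n j"
    using True j by auto
  \<comment> \<open>Subtraction is truncated; \<open>Suc (m j) \<le> n j\<close> ensures that adding
    the step back restores \<open>n j - m j\<close>.\<close>
  then have "n'(j := Suc (n' j)) = (\<lambda>i. n i - m i)"
    by (intro ext) (simp add: n'_def Suc_diff_Suc)
  then show ?thesis
    using nn_integral_potential_step[OF j, of n' x] True le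
    by (simp add: bounded_potential_def n'_def del: fun_upd_apply)
next
  case False
  then have "bounded_potential n (m(j := Suc (m j))) y = 0" for y
    unfolding bounded_potential_def by (rule if_not_P)
  then show ?thesis
    by simp
qed

end

section \<open>Step counts and the supermartingale along the walk\<close>

definition uses :: "(nat \<Rightarrow> 'w \<Rightarrow> nat) \<Rightarrow> nat \<Rightarrow> 'w \<Rightarrow> nat \<Rightarrow> nat" where
  "uses l t \<omega> j = card {i. i < t \<and> l i \<omega> = j}"

lemma uses_0: "uses l 0 \<omega> = (\<lambda>_. 0)"
  by (simp add: uses_def fun_eq_iff)

lemma uses_Suc: "uses l (Suc t) \<omega> = (uses l t \<omega>)(l t \<omega> := Suc (uses l t \<omega> (l t \<omega>)))"
proof
  fix j
  have "{i. i < Suc t \<and> l i \<omega> = j} =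
      (if l t \<omega> = j then insert t {i. i < t \<and> l i \<omega> = j} else {i. i < t \<and> l i \<omega> = j})"
    by (auto simp: less_Suc_eq)
  then show "uses l (Suc t) \<omega> j = ((uses l t \<omega>)(l t \<omega> := Suc (uses l t \<omega> (l t \<omega>)))) j"
    by (simp add: uses_def)
qed

lemma sum_uses:
  assumes "\<And>i. i < t \<Longrightarrow> l i \<omega> \<in> J" "finite J"
  shows "(\<Sum>j\<in>J. uses l t \<omega> j) = t"
  using assms(1)
proof (induction t)
  case 0
  then show ?case
    by (simp add: uses_0)
next
  case (Suc t)
  then have "l t \<omega> \<in> J"
    by simp
  then have "(\<Sum>j\<in>J. uses l (Suc t) \<omega> j) = Suc (\<Sum>j\<in>J. uses l t \<omega> j)"
    using assms(2) by (simp add: uses_Suc sum.remove[OF assms(2), of "l t \<omega>"])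
  then show ?case
    using Suc by simp
qed

text \<open>Independence from the past is stated for one index \<open>j\<close> at a time: on the
  event that the rule selects \<open>j\<close>, the walk moves by \<open>\<xi> j (Suc i)\<close>
  alone. Steps with different \<open>j\<close> may depend on each other.\<close>

locale adaptive_walk = weighted_steps W J \<mu> + prob_space M
  for W :: "'a::euclidean_space measure" and J \<mu> and M :: "'w measure" +
  fixes \<xi> :: "nat \<Rightarrow> nat \<Rightarrow> 'w \<Rightarrow> 'a" and F :: "nat \<Rightarrow> 'w measure" and l :: "nat \<Rightarrow> 'w \<Rightarrow> nat"
  assumes subalg: "subalgebra M (F i)" and F_mono: "i \<le> i' \<Longrightarrow> sets (F i) \<subseteq> sets (F i')"
    and \<xi>_adapted: "j \<in> J \<Longrightarrow> \<xi> j (Suc i) \<in> borel_measurable (F (Suc i))"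
    and \<xi>_law: "j \<in> J \<Longrightarrow> distr M borel (\<xi> j (Suc i)) = \<mu> j"
    and \<xi>_indep: "j \<in> J \<Longrightarrow> A \<in> sets (F i) \<Longrightarrow> B \<in> sets borel \<Longrightarrow>
      prob (A \<inter> (\<xi> j (Suc i) -` B \<inter> space M)) = prob A * prob (\<xi> j (Suc i) -` B \<inter> space M)"
    and l_adapted: "l i \<in> measurable (F i) (count_space J)"
begin

lemma space_F: "space (F i) = space M"
  using subalg[of i] by (simp add: subalgebra_def)

lemma measurable_F_mono: "f \<in> measurable (F i) N \<Longrightarrow> i \<le> i' \<Longrightarrow> f \<in> measurable (F i') N"
  using F_mono[of i i'] by (auto simp: measurable_def space_F)

lemma l_in_J: "\<omega> \<in> space M \<Longrightarrow> l i \<omega> \<in> J"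
  using measurable_space[OF l_adapted, of \<omega> i] by (simp add: space_F)

lemma l_measurable [measurable]: "l i \<in> measurable (F i) (count_space UNIV)"
proof -
  have "(\<lambda>x. x) \<in> measurable (count_space J) (count_space (UNIV :: nat set))"
    by simp
  from measurable_compose[OF l_adapted this] show ?thesis .
qed

lemma uses_measurable [measurable]: "(\<lambda>\<omega>. uses l t \<omega> j) \<in> measurable (F t) (count_space UNIV)"
proof (induction t)
  case 0
  then show ?case
    by (simp add: uses_0)
next
  case (Suc t)
  then have [measurable]: "(\<lambda>\<omega>. uses l t \<omega> j) \<in> measurable (F t) (count_space UNIV)" .
  have "(\<lambda>\<omega>. if j = l t \<omega> then Suc (uses l t \<omega> j) else uses l t \<omega> j)
      \<in> measurable (F t) (count_space UNIV)"
    by measurable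
  moreover have "uses l (Suc t) \<omega> j = (if j = l t \<omega> then Suc (uses l t \<omega> j) else uses l t \<omega> j)" for \<omega>
    by (simp add: uses_Suc)
  ultimately show ?case
    by (auto intro: measurable_F_mono[of _ t])
qed

lemma walk_measurable [measurable]: "walk \<xi> l t \<in> borel_measurable (F t)"
proof (induction t)
  case 0
  then show ?case
    by (simp add: measurable_cong[of _ "walk \<xi> l 0" "\<lambda>_. 0"])
next
  case (Suc t)
  then have [measurable]: "walk \<xi> l t \<in> borel_measurable (F (Suc t))"
    by (rule measurable_F_mono) simp
  have [measurable]: "l t \<in> measurable (F (Suc t)) (count_space UNIV)"
    by (rule measurable_F_mono[OF l_measurable]) simp
  note [measurable] = \<xi>_adapted
  have "(\<lambda>\<omega>. walk \<xi> l t \<omega> + (\<Sum>j\<in>J. if l t \<omega> = j then \<xi> j (Suc t) \<omega> else 0))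
      \<in> borel_measurable (F (Suc t))"
    by measurable
  also have "?this \<longleftrightarrow> walk \<xi> l (Suc t) \<in> borel_measurable (F (Suc t))"
    using finite_J by (intro measurable_cong) (simp add: space_F l_in_J)
  finally show ?case .
qed

text \<open>The choice \<open>l t\<close> is known at time \<open>t\<close>, so the expectation
  splits over its value \<open>j\<close>. On each piece the next step is fresh with law
  \<open>\<mu> j\<close>, and averaging it does not increase the bounded potential, whichever
  \<open>j\<close> was chosen. Hence the bound is uniform over adapted rules.\<close>

lemma potential_supermartingale:
  "(\<integral>\<^sup>+\<omega>. bounded_potential n (uses l (Suc t) \<omega>) (walk \<xi> l (Suc t) \<omega>) \<partial>M)
    \<le> (\<integral>\<^sup>+\<omega>. bounded_potential n (uses l t \<omega>) (walk \<xi> l t \<omega>) \<partial>M)"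
proof -
  \<comment> \<open>The past \<open>\<omega>\<close> and the new step \<open>y\<close> are separate
    arguments; \<open>of_bool\<close> leaves only the summand of the selected index.\<close>
  define H where "H = (\<lambda>j \<omega> y. of_bool (l t \<omega> = j) *
    bounded_potential n ((uses l t \<omega>)(j := Suc (uses l t \<omega> j))) (walk \<xi> l t \<omega> + y))"
  have H [measurable]: "(\<lambda>(\<omega>, y). H j \<omega> y) \<in> borel_measurable (F t \<Otimes>\<^sub>M borel)" if "j \<in> J" for j
  proof -
    have [measurable]: "(\<lambda>p. uses l t (fst p) i) \<in> measurable (F t \<Otimes>\<^sub>M borel) (count_space UNIV)" for i
      by (rule measurable_compose[OF measurable_fst uses_measurable])
    show ?thesis
      unfolding H_def fun_upd_def case_prod_beta by measurable
  qed
  have \<xi>_M [measurable]: "\<xi> j (Suc t) \<in> borel_measurable M" if "j \<in> J" for j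
    by (rule measurable_from_subalg[OF subalg \<xi>_adapted[OF that]])
  have id [measurable]: "(\<lambda>\<omega>. \<omega>) \<in> measurable M (F t)"
    by (rule measurable_from_subalg[OF subalg[of t]]) simp
  have HM [measurable]: "(\<lambda>\<omega>. H j \<omega> (\<xi> j (Suc t) \<omega>)) \<in> borel_measurable M" if j: "j \<in> J" for j
  proof -
    have "(\<lambda>\<omega>. (\<omega>, \<xi> j (Suc t) \<omega>)) \<in> measurable M (F t \<Otimes>\<^sub>M borel)"
      using j by measurable
    from measurable_compose[OF this H[OF j]] show ?thesis
      by simp
  qed
  have PM [measurable]: "(\<lambda>\<omega>. bounded_potential n (uses l t \<omega>) (walk \<xi> l t \<omega>)) \<in> borel_measurable M"
    and lM [measurable]: "l t \<in> measurable M (count_space UNIV)"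
    by (rule measurable_from_subalg[OF subalg[of t]], measurable)+
  have "(\<integral>\<^sup>+\<omega>. bounded_potential n (uses l (Suc t) \<omega>) (walk \<xi> l (Suc t) \<omega>) \<partial>M)
      = (\<integral>\<^sup>+\<omega>. (\<Sum>j\<in>J. H j \<omega> (\<xi> j (Suc t) \<omega>)) \<partial>M)"
  proof (rule nn_integral_cong)
    fix \<omega> assume "\<omega> \<in> space M"
    then have l: "l t \<omega> \<in> J"
      by (rule l_in_J)
    have "(\<Sum>j\<in>J - {l t \<omega>}. H j \<omega> (\<xi> j (Suc t) \<omega>)) = 0"
      by (rule sum.neutral) (auto simp: H_def)
    then show "bounded_potential n (uses l (Suc t) \<omega>) (walk \<xi> l (Suc t) \<omega>)
        = (\<Sum>j\<in>J. H j \<omega> (\<xi> j (Suc t) \<omega>))"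
      by (simp add: sum.remove[OF finite_J l] uses_Suc H_def)
  qed
  also have "\<dots> = (\<Sum>j\<in>J. \<integral>\<^sup>+\<omega>. H j \<omega> (\<xi> j (Suc t) \<omega>) \<partial>M)"
    by (rule nn_integral_sum) simp
  \<comment> \<open>\<open>H j\<close> depends on \<open>\<omega>\<close> only through
    \<open>F t\<close>, so \<open>\<xi> j (Suc t)\<close> can be integrated out separately under its
    law.\<close>
  also have "\<dots> = (\<Sum>j\<in>J. \<integral>\<^sup>+\<omega>. \<integral>\<^sup>+y. H j \<omega> y \<partial>\<mu> j \<partial>M)"
    by (intro sum.cong refl, subst nn_integral_indep_subalgebra[OF subalg \<xi>_M \<xi>_indep H])
       (simp_all add: \<xi>_law)
  also have "\<dots> \<le> (\<Sum>j\<in>J. \<integral>\<^sup>+\<omega>. of_bool (l t \<omega> = j) *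
      bounded_potential n (uses l t \<omega>) (walk \<xi> l t \<omega>) \<partial>M)"
  proof (intro sum_mono nn_integral_mono)
    fix j \<omega> assume j: "j \<in> J"
    note [measurable_cong] = sets_\<mu>[OF j]
    have "(\<lambda>y. bounded_potential n ((uses l t \<omega>)(j := Suc (uses l t \<omega> j))) (walk \<xi> l t \<omega> + y))
        \<in> borel_measurable (\<mu> j)"
      by measurable
    then have "(\<integral>\<^sup>+y. H j \<omega> y \<partial>\<mu> j) = of_bool (l t \<omega> = j) *
        (\<integral>\<^sup>+y. bounded_potential n ((uses l t \<omega>)(j := Suc (uses l t \<omega> j))) (walk \<xi> l t \<omega> + y) \<partial>\<mu> j)"
      unfolding H_def by (rule nn_integral_cmult)
    also have "\<dots> \<le> of_bool (l t \<omega> = j) * bounded_potential n (uses l t \<omega>) (walk \<xi> l t \<omega>)"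
      by (intro mult_left_mono nn_integral_bounded_potential_step j) simp
    finally show "(\<integral>\<^sup>+y. H j \<omega> y \<partial>\<mu> j)
        \<le> of_bool (l t \<omega> = j) * bounded_potential n (uses l t \<omega>) (walk \<xi> l t \<omega>)" .
  qed
  also have "\<dots> = (\<integral>\<^sup>+\<omega>. (\<Sum>j\<in>J. of_bool (l t \<omega> = j) *
      bounded_potential n (uses l t \<omega>) (walk \<xi> l t \<omega>)) \<partial>M)"
    by (rule nn_integral_sum[symmetric]) measurable
  also have "\<dots> = (\<integral>\<^sup>+\<omega>. bounded_potential n (uses l t \<omega>) (walk \<xi> l t \<omega>) \<partial>M)"
  proof (rule nn_integral_cong)
    fix \<omega> assume "\<omega> \<in> space M"
    then have l: "l t \<omega> \<in> J"
      by (rule l_in_J)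
    have "(\<Sum>j\<in>J - {l t \<omega>}. of_bool (l t \<omega> = j) *
        bounded_potential n (uses l t \<omega>) (walk \<xi> l t \<omega>)) = 0"
      by (rule sum.neutral) auto
    then show "(\<Sum>j\<in>J. of_bool (l t \<omega> = j) *
        bounded_potential n (uses l t \<omega>) (walk \<xi> l t \<omega>)) = bounded_potential n (uses l t \<omega>) (walk \<xi> l t \<omega>)"
      by (simp add: sum.remove[OF finite_J l])
  qed
  finally show ?thesis .
qed

lemma nn_integral_bounded_potential_le:
  "(\<integral>\<^sup>+\<omega>. bounded_potential n (uses l t \<omega>) (walk \<xi> l t \<omega>) \<partial>M) \<le> ennreal (Re (potential n 0))"
proof (induction t)
  case 0
  then show ?case
    by (simp add: uses_0 bounded_potential_def emeasure_space_1)
next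
  case (Suc t)
  then show ?case
    using potential_supermartingale[of n t] by simp
qed

section \<open>Counting the possible step counts\<close>

definition compositions :: "nat \<Rightarrow> (nat \<Rightarrow> nat) set" where
  "compositions t = {n \<in> PiE J (\<lambda>_. {..t}). (\<Sum>j\<in>J. n j) = t}"

lemma finite_compositions: "finite (compositions t)"
  unfolding compositions_def using finite_J by (auto intro!: finite_PiE)

text \<open>The total \<open>t\<close> determines the count at one chosen \<open>j\<close> from the
  other counts, which saves one factor \<open>t + 1\<close>. Functions in \<open>PiE\<close> agree
  outside \<open>J\<close>; this makes restriction to \<open>J - {j}\<close> injective.\<close>

lemma card_compositions:
  assumes "J \<noteq> {}"
  shows "card (compositions t) \<le> (t + 1) ^ (card J - 1)"
proof -
  obtain j where j: "j \<in> J"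
    using assms by auto
  have "inj_on (\<lambda>n. restrict n (J - {j})) (compositions t)"
  proof (rule inj_onI)
    fix n n' assume n: "n \<in> compositions t" "n' \<in> compositions t"
      and eq: "restrict n (J - {j}) = restrict n' (J - {j})"
    have eq: "n i = n' i" if "i \<in> J - {j}" for i
      using fun_cong[OF eq, of i] that by simp
    have "n j + (\<Sum>i\<in>J - {j}. n i) = n' j + (\<Sum>i\<in>J - {j}. n' i)"
      using n sum.remove[OF finite_J j, of n] sum.remove[OF finite_J j, of n']
      by (simp add: compositions_def)
    moreover have "(\<Sum>i\<in>J - {j}. n i) = (\<Sum>i\<in>J - {j}. n' i)"
      by (rule sum.cong) (use eq in auto)
    ultimately have "n i = n' i" if "i \<in> J" for i
      using eq that by (cases "i = j") auto
    then show "n = n'"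
      using n by (auto simp: compositions_def intro: PiE_ext)
  qed
  moreover have "(\<lambda>n. restrict n (J - {j})) ` compositions t \<subseteq> PiE (J - {j}) (\<lambda>_. {..t})"
  proof (rule image_subsetI)
    fix n assume "n \<in> compositions t"
    then have "n i \<in> {..t}" if "i \<in> J" for i
      using that by (intro PiE_mem[of n J]) (auto simp: compositions_def)
    then show "restrict n (J - {j}) \<in> PiE (J - {j}) (\<lambda>_. {..t})"
      by (intro PiE_I) auto
  qed
  moreover have "finite (PiE (J - {j}) (\<lambda>_. {..t}))"
    using finite_J by (auto intro!: finite_PiE)
  ultimately have "card (compositions t) \<le> card (PiE (J - {j}) (\<lambda>_. {..t}))"
    by (rule card_inj_on_le)
  also have "\<dots> = (t + 1) ^ (card J - 1)"
    using finite_J j by (simp add: card_PiE)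
  finally show ?thesis .
qed

text \<open>The counts actually made by time \<open>t\<close> form a member of
  \<open>compositions t\<close>. For that \<open>n\<close> no step is left and the bounded potential
  is \<open>char_fun W\<close> at the walk; the other terms are nonnegative and only enlarge the
  sum.\<close>

lemma nn_integral_char_fun_walk_le:
  "(\<integral>\<^sup>+\<omega>. ennreal (Re (char_fun W (walk \<xi> l t \<omega>))) \<partial>M)
    \<le> (\<Sum>n\<in>compositions t. ennreal (Re (potential n 0)))"
proof -
  have [measurable]: "(\<lambda>\<omega>. bounded_potential n (uses l t \<omega>) (walk \<xi> l t \<omega>)) \<in> borel_measurable M" for n
    by (rule measurable_from_subalg[OF subalg[of t]]) measurable
  have "(\<integral>\<^sup>+\<omega>. ennreal (Re (char_fun W (walk \<xi> l t \<omega>))) \<partial>M)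
      \<le> (\<integral>\<^sup>+\<omega>. (\<Sum>n\<in>compositions t. bounded_potential n (uses l t \<omega>) (walk \<xi> l t \<omega>)) \<partial>M)"
  proof (rule nn_integral_mono)
    fix \<omega> assume \<omega>: "\<omega> \<in> space M"
    define n where "n = restrict (uses l t \<omega>) J"
    have sum: "(\<Sum>j\<in>J. uses l t \<omega> j) = t"
      using l_in_J[OF \<omega>] finite_J by (intro sum_uses)
    then have "uses l t \<omega> j \<le> t" if "j \<in> J" for j
      using member_le_sum[OF that, of "uses l t \<omega>"] finite_J by simp
    then have "n \<in> compositions t"
      using sum by (auto simp: n_def compositions_def)
    moreover have "bounded_potential n (uses l t \<omega>) (walk \<xi> l t \<omega>)
        = ennreal (Re (char_fun W (walk \<xi> l t \<omega>)))"
      by (simp add: bounded_potential_def n_def potential_eq_char_fun)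
    ultimately show "ennreal (Re (char_fun W (walk \<xi> l t \<omega>)))
        \<le> (\<Sum>n\<in>compositions t. bounded_potential n (uses l t \<omega>) (walk \<xi> l t \<omega>))"
      using member_le_sum[of n "compositions t" "\<lambda>n. bounded_potential n (uses l t \<omega>) (walk \<xi> l t \<omega>)"]
        finite_compositions by simp
  qed
  also have "\<dots> = (\<Sum>n\<in>compositions t. \<integral>\<^sup>+\<omega>. bounded_potential n (uses l t \<omega>) (walk \<xi> l t \<omega>) \<partial>M)"
    by (rule nn_integral_sum) simp
  also have "\<dots> \<le> (\<Sum>n\<in>compositions t. ennreal (Re (potential n 0)))"
    by (intro sum_mono nn_integral_bounded_potential_le)
  finally show ?thesis .
qed

end

section \<open>Gaussian decay and summability over time\<close>

context adaptive_walk
begin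

text \<open>On the ball that carries \<open>W\<close> the product of characteristic functions is at
  most \<open>exp (- (c * t) * (norm \<theta>)\<^sup>2)\<close>, however the \<open>t\<close> steps
  are split among the laws. The density bound for \<open>W\<close> reduces this to a Gaussian
  integral.\<close>

lemma potential_le_gaussian:
  fixes c r :: real
  assumes r: "r > 0" and c: "c > 0" and t: "t > 0"
    and ball: "AE \<theta> in W. norm \<theta> \<le> 2 * r"
    and dens: "\<And>h. h \<in> borel_measurable borel \<Longrightarrow>
       (\<integral>\<^sup>+\<theta>. h \<theta> \<partial>W) \<le> (\<integral>\<^sup>+\<theta>. h \<theta> \<partial>lborel) / emeasure lborel (cball (0::'a) r)"
    and decay: "\<And>j \<theta>. j \<in> J \<Longrightarrow> norm \<theta> \<le> 2 * r \<Longrightarrow>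
       cmod (char_fun (\<mu> j) \<theta>) \<le> exp (- c * (norm \<theta>)\<^sup>2)"
    and n: "(\<Sum>j\<in>J. n j) = t"
  shows "Re (potential n 0)
    \<le> sqrt (pi / (c * t)) ^ DIM('a) / measure lborel (cball (0::'a) r)"
proof -
  let ?V = "measure lborel (cball (0::'a) r)"
  have V: "emeasure lborel (cball (0::'a) r) = ennreal ?V" "?V > 0"
    using r emeasure_lborel_cball_finite[of "0::'a" r] content_cball_pos[of r "0::'a"]
    by (auto simp: emeasure_eq_ennreal_measure)
  have prod_le: "cmod (cis (\<theta> \<bullet> 0) * (\<Prod>j\<in>J. char_fun (\<mu> j) \<theta> ^ n j)) \<le> exp (- (c * t) * (norm \<theta>)\<^sup>2)"
    if "norm \<theta> \<le> 2 * r" for \<theta>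
  proof -
    have "(\<Prod>j\<in>J. cmod (char_fun (\<mu> j) \<theta>) ^ n j) \<le> (\<Prod>j\<in>J. exp (- c * (norm \<theta>)\<^sup>2) ^ n j)"
      using decay that by (intro prod_mono conjI power_mono) auto
    also have "\<dots> = exp (- (c * t) * (norm \<theta>)\<^sup>2)"
      by (simp only: power_sum[symmetric] n) (simp add: exp_of_nat_mult[symmetric] mult_ac)
    finally show ?thesis
      by (simp add: prod_norm[symmetric] norm_power)
  qed
  have "ennreal (Re (potential n 0)) \<le> ennreal (cmod (potential n 0))"
    by (intro ennreal_leI complex_Re_le_cmod)
  also have "\<dots> \<le> (\<integral>\<^sup>+\<theta>. ennreal (cmod (cis (\<theta> \<bullet> 0) * (\<Prod>j\<in>J. char_fun (\<mu> j) \<theta> ^ n j))) \<partial>W)"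
    unfolding potential_def
    by (intro integral_norm_bound_ennreal W.integrable_const_bound[where B=1])
       (auto simp only: norm_integrand_le_1 AE_I2, measurable)
  also have "\<dots> \<le> (\<integral>\<^sup>+\<theta>. ennreal (exp (- (c * t) * (norm \<theta>)\<^sup>2)) \<partial>W)"
  proof (rule nn_integral_mono_AE)
    show "AE \<theta> in W. ennreal (cmod (cis (\<theta> \<bullet> 0) * (\<Prod>j\<in>J. char_fun (\<mu> j) \<theta> ^ n j)))
        \<le> ennreal (exp (- (c * t) * (norm \<theta>)\<^sup>2))"
      using ball by eventually_elim (rule ennreal_leI[OF prod_le])
  qed
  also have "\<dots> \<le> (\<integral>\<^sup>+\<theta>. ennreal (exp (- (c * t) * (norm \<theta>)\<^sup>2)) \<partial>(lborel :: 'a measure))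
      / emeasure lborel (cball (0::'a) r)"
    by (rule dens) measurable
  also have "\<dots> = ennreal (sqrt (pi / (c * t)) ^ DIM('a) / ?V)"
    using c t V(2) by (subst nn_integral_gaussian) (auto simp: V(1) divide_ennreal)
  finally show ?thesis
    using V(2) c t by (subst (asm) ennreal_le_iff) (auto intro!: divide_nonneg_nonneg)
qed

text \<open>This is a Borel-Cantelli argument with \<open>char_fun W\<close> in place of an
  indicator: its expectations along the walk are summable, so almost surely its values tend to 0,
  whereas on the ball \<open>r * norm x \<le> 1\<close> they are at least 1/4.\<close>

lemma eventually_outside_ball:
  fixes c r :: real
  assumes r: "r > 0" and c: "c > 0"
    and ball: "AE \<theta> in W. norm \<theta> \<le> 2 * r"
    and dens: "\<And>h. h \<in> borel_measurable borel \<Longrightarrow>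
       (\<integral>\<^sup>+\<theta>. h \<theta> \<partial>W) \<le> (\<integral>\<^sup>+\<theta>. h \<theta> \<partial>lborel) / emeasure lborel (cball (0::'a) r)"
    and decay: "\<And>j \<theta>. j \<in> J \<Longrightarrow> norm \<theta> \<le> 2 * r \<Longrightarrow>
       cmod (char_fun (\<mu> j) \<theta>) \<le> exp (- c * (norm \<theta>)\<^sup>2)"
    and quarter: "\<And>x. r * norm x \<le> 1 \<Longrightarrow> 1 / 4 \<le> Re (char_fun W x)"
    and dim: "2 * card J + 1 \<le> DIM('a)" and J: "J \<noteq> {}"
  shows "AE \<omega> in M. eventually (\<lambda>t. r * norm (walk \<xi> l t \<omega>) > 1) sequentially"
proof -
  let ?d = "DIM('a)" and ?k = "card J - 1"
  let ?V = "measure lborel (cball (0::'a) r)"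
  \<comment> \<open>The power of 2 comes from \<open>?T + 1 \<le> 2 * ?T\<close>; the other factor
    collects the constants of the Gaussian bound.\<close>
  define C where "C = 2 ^ ?k * (sqrt (pi / c) ^ ?d / ?V)"
  \<comment> \<open>Time is shifted by one, since the Gaussian bound requires at least one
    step.\<close>
  define g where "g = (\<lambda>t \<omega>. Re (char_fun W (walk \<xi> l (Suc t) \<omega>)))"
  have g: "g t \<omega> \<ge> 0" for t \<omega>
    using char_W by (simp add: g_def complex_nonneg_Reals_iff)
  have V: "?V > 0"
    using r by (rule content_cball_pos)
  have C: "C \<ge> 0"
    using V c by (simp add: C_def)
  have cardJ: "card J \<ge> 1"
    using finite_J J by (simp add: Suc_le_eq card_gt_0_iff)
  have g_le: "(\<integral>\<^sup>+\<omega>. ennreal (g t \<omega>) \<partial>M) \<le> ennreal (C * real (Suc t) powr (- 3 / 2))" for t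
  proof -
    let ?T = "real (Suc t)"
    let ?b = "sqrt (pi / (c * ?T)) ^ ?d / ?V"
    have b: "?b \<ge> 0"
      using V c by simp
    have "(\<integral>\<^sup>+\<omega>. ennreal (g t \<omega>) \<partial>M) \<le> (\<Sum>n\<in>compositions (Suc t). ennreal (Re (potential n 0)))"
      unfolding g_def by (rule nn_integral_char_fun_walk_le)
    also have "\<dots> \<le> (\<Sum>n\<in>compositions (Suc t). ennreal ?b)"
      by (intro sum_mono ennreal_leI potential_le_gaussian[OF r c _ ball dens decay])
         (auto simp: compositions_def)
    also have "\<dots> = ennreal (real (card (compositions (Suc t))) * ?b)"
      unfolding sum_constant ennreal_of_nat_eq_real_of_nat
      using b by (intro ennreal_mult[symmetric]) auto
    also have "\<dots> \<le> ennreal (C * ?T powr (- 3 / 2))"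
    proof (rule ennreal_leI)
      have "real (card (compositions (Suc t))) \<le> (?T + 1) ^ ?k"
        using card_compositions[OF J, of "Suc t"]
        by (metis (no_types, lifting) Suc_eq_plus1 of_nat_Suc of_nat_le_iff of_nat_power add.commute)
      also have "\<dots> \<le> (2 * ?T) ^ ?k"
        by (intro power_mono) auto
      finally have card: "real (card (compositions (Suc t))) \<le> 2 ^ ?k * ?T powr real ?k"
        by (simp add: power_mult_distrib powr_realpow del: of_nat_Suc)
      have "sqrt (pi / (c * x)) ^ ?d = sqrt (pi / c) ^ ?d * x powr (- real ?d / 2)" if "x > 0" for x
      proof -
        have "x powr (- 1 / 2) = 1 / sqrt x"
          using that powr_minus_divide[of x "1 / 2"] by (simp add: powr_half_sqrt)
        then have "sqrt (pi / (c * x)) = sqrt (pi / c) * x powr (- 1 / 2)"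
          by (simp add: real_sqrt_divide real_sqrt_mult)
        then show ?thesis
          using that by (simp add: power_mult_distrib powr_power)
      qed
      from this[of ?T] have b_eq: "?b = (sqrt (pi / c) ^ ?d / ?V) * ?T powr (- real ?d / 2)"
        by (simp del: of_nat_Suc)
      have "real (card (compositions (Suc t))) * ?b
          \<le> (2 ^ ?k * ?T powr real ?k) * ((sqrt (pi / c) ^ ?d / ?V) * ?T powr (- real ?d / 2))"
        using card b unfolding b_eq[symmetric] by (rule mult_right_mono)
      also have "\<dots> = C * ?T powr (real ?k + - real ?d / 2)"
        unfolding powr_add C_def by (simp only: mult_ac)
      \<comment> \<open>The dimension enters here: for \<open>k = card J\<close> and
        \<open>d \<ge> 2 * k + 1\<close>, the exponent \<open>k - 1 - d / 2\<close> is at most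
        \<open>- 3 / 2\<close>.\<close>
      also have "\<dots> \<le> C * ?T powr (- 3 / 2)"
        using dim cardJ C by (intro mult_left_mono powr_mono) (auto simp: of_nat_diff)
      finally show "real (card (compositions (Suc t))) * ?b \<le> C * ?T powr (- 3 / 2)" .
    qed
    finally show ?thesis .
  qed
  have [measurable]: "char_fun W \<in> borel_measurable borel"
    unfolding char_fun_def by measurable
  have [measurable]: "walk \<xi> l t \<in> borel_measurable M" for t
    by (rule measurable_from_subalg[OF subalg walk_measurable])
  have [measurable]: "g t \<in> borel_measurable M" for t
    unfolding g_def by measurable
  have "summable (\<lambda>t. C * real (Suc t) powr (- 3 / 2))"
    by (intro summable_mult iffD2[OF summable_Suc_iff[of "\<lambda>t. real t powr (- 3 / 2)"]])
       (simp add: summable_real_powr_iff)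
  then have "(\<Sum>t. ennreal (C * real (Suc t) powr (- 3 / 2))) < \<infinity>"
    using C by (simp add: suminf_ennreal2 del: of_nat_Suc)
  moreover have "(\<integral>\<^sup>+\<omega>. (\<Sum>t. ennreal (g t \<omega>)) \<partial>M) \<le> (\<Sum>t. ennreal (C * real (Suc t) powr (- 3 / 2)))"
    using g_le by (subst nn_integral_suminf) (auto intro!: suminf_le)
  ultimately have "(\<integral>\<^sup>+\<omega>. (\<Sum>t. ennreal (g t \<omega>)) \<partial>M) \<noteq> \<infinity>"
    by auto
  then have "AE \<omega> in M. (\<Sum>t. ennreal (g t \<omega>)) \<noteq> \<infinity>"
    by (intro nn_integral_PInf_AE) measurable
  then show ?thesis
  proof eventually_elim
    case (elim \<omega>)
    then have "summable (\<lambda>t. g t \<omega>)"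
      using g by (intro summable_suminf_not_top) auto
    then have "(\<lambda>t. g t \<omega>) \<longlonglongrightarrow> 0"
      by (rule summable_LIMSEQ_zero)
    then have "eventually (\<lambda>t. g t \<omega> < 1 / 4) sequentially"
      by (rule order_tendstoD) simp
    then have "eventually (\<lambda>t. r * norm (walk \<xi> l (Suc t) \<omega>) > 1) sequentially"
      by eventually_elim (use quarter in \<open>force simp: g_def not_le[symmetric]\<close>)
    then show ?case
      by (subst (asm) eventually_sequentially_Suc)
  qed
qed

end

section \<open>Transience: common constants and growing balls\<close>

theorem proposition1p4:
  fixes k :: nat
    and \<beta> :: real
    and \<mu> :: "nat \<Rightarrow> (real ^ 'd) measure"
    and M :: "'w measure"
    and \<xi> :: "nat \<Rightarrow> nat \<Rightarrow> 'w \<Rightarrow> real ^ 'd"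
    and F :: "nat \<Rightarrow> 'w measure"
    and l :: "nat \<Rightarrow> 'w \<Rightarrow> nat"
  assumes "CARD('d) \<ge> 2 * k + 1"
    and "\<beta> > 0"
    and "\<And>j. j \<in> {1..k} \<Longrightarrow> prob_space (\<mu> j) \<and> sets (\<mu> j) = sets borel"
    and "\<And>j. j \<in> {1..k} \<Longrightarrow> full_dimensional (\<mu> j)"
    and "\<And>j. j \<in> {1..k} \<Longrightarrow> mean_zero (\<mu> j)"
    and "\<And>j. j \<in> {1..k} \<Longrightarrow> has_moments (2 + \<beta>) (\<mu> j)"
    and "prob_space M"
    and "iid_steps M k \<mu> \<xi>"
    and "history_filtration M k \<xi> F"
    and "adapted_rule k F l"
  shows "transient M (walk \<xi> l)"
proof -
  interpret prob_space M
    by fact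
  define J where "J = {1..k}"
  have hist: "subalgebra M (F i)" "i \<le> i' \<Longrightarrow> sets (F i) \<subseteq> sets (F i')"
    "j \<in> J \<Longrightarrow> \<xi> j (Suc i) \<in> borel_measurable (F (Suc i))" for i i' j
    using assms(9) by (auto simp: history_filtration_def filtration_def J_def)
  have l: "l i \<in> measurable (F i) (count_space J)" for i
    using assms(10) by (simp add: adapted_rule_def J_def)
  have law: "distr M borel (\<xi> j (Suc i)) = \<mu> j" if "j \<in> J" for i j
    using assms(8) that by (simp add: iid_steps_def J_def)
  \<comment> \<open>Each \<open>\<xi> j (Suc i)\<close> is a coordinate of the vector of next steps,
    so its events lie in the pulled-back sigma-algebra to which the assumed independence
    applies.\<close>
  have indep: "prob (A \<inter> (\<xi> j (Suc i) -` B \<inter> space M)) = prob A * prob (\<xi> j (Suc i) -` B \<inter> space M)"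
    if j: "j \<in> J" and A: "A \<in> sets (F i)" and B: "B \<in> sets borel" for i j A B
  proof -
    let ?X = "\<lambda>\<omega>. \<lambda>j\<in>{1..k}. \<xi> j (Suc i) \<omega>"
    let ?V = "vimage_algebra (space M) ?X (Pi\<^sub>M {1..k} (\<lambda>_. borel))"
    have "?X \<in> measurable ?V (Pi\<^sub>M {1..k} (\<lambda>_. borel))"
      by (rule measurable_vimage_algebra1) (auto simp: space_PiM)
    moreover have "(\<lambda>x. x j) \<in> measurable (Pi\<^sub>M {1..k} (\<lambda>_. borel :: (real ^ 'd) measure)) borel"
      using j by (intro measurable_component_singleton) (simp add: J_def)
    ultimately have "(\<lambda>\<omega>. ?X \<omega> j) \<in> measurable ?V borel"
      by (rule measurable_compose)
    then have "\<xi> j (Suc i) \<in> measurable ?V borel"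
      using j by (simp add: J_def)
    from measurable_sets[OF this B] have "\<xi> j (Suc i) -` B \<inter> space M \<in> sets ?V"
      by simp
    moreover have "indep_set (sets (F i)) (sets ?V)"
      using assms(9) by (simp add: history_filtration_def)
    ultimately show ?thesis
      using A by (simp add: indep_sets2_eq)
  qed
  have \<mu>: "prob_space (\<mu> j)" "sets (\<mu> j) = sets borel" if "j \<in> J" for j
    using assms(3) that by (auto simp: J_def)
  \<comment> \<open>\<open>k \<ge> 1\<close> follows from the rule itself, whose values at points of
    the nonempty space lie in \<open>{1..k}\<close>.\<close>
  obtain \<omega> where "\<omega> \<in> space M"
    using not_empty by auto
  then have J: "J \<noteq> {}"
    using measurable_space[OF l, of \<omega> 0] hist(1)[of 0] by (auto simp: subalgebra_def)
  have finJ: "finite J"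
    by (simp add: J_def)
  have "\<exists>a \<delta>. a > 0 \<and> \<delta> > 0 \<and> (\<forall>\<theta>. norm \<theta> \<le> \<delta> \<longrightarrow> cmod (char_fun (\<mu> j) \<theta>) \<le> exp (- a * (norm \<theta>)\<^sup>2))"
    if "j \<in> J" for j
    using char_fun_gaussian_bound[of "\<mu> j" \<beta>] assms(2) assms(3-6)[of j] that unfolding J_def by metis
  then obtain a \<delta> where a: "\<And>j. j \<in> J \<Longrightarrow> a j > 0" and \<delta>: "\<And>j. j \<in> J \<Longrightarrow> \<delta> j > 0"
    and decay: "\<And>j \<theta>. j \<in> J \<Longrightarrow> norm \<theta> \<le> \<delta> j \<Longrightarrow> cmod (char_fun (\<mu> j) \<theta>) \<le> exp (- a j * (norm \<theta>)\<^sup>2)"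
    by metis
  \<comment> \<open>Minima over the finite set of indices give one decay rate and one radius for all
    laws.\<close>
  define c where "c = Min (a ` J)"
  define \<epsilon> where "\<epsilon> = Min (\<delta> ` J)"
  have c: "c > 0" and \<epsilon>: "\<epsilon> > 0"
    using a \<delta> J finJ by (auto simp: c_def \<epsilon>_def)
  have decay': "cmod (char_fun (\<mu> j) \<theta>) \<le> exp (- c * (norm \<theta>)\<^sup>2)" if "j \<in> J" "norm \<theta> \<le> \<epsilon>" for j \<theta>
  proof -
    have "\<epsilon> \<le> \<delta> j" "c \<le> a j"
      using that finJ by (auto simp: c_def \<epsilon>_def)
    then have "cmod (char_fun (\<mu> j) \<theta>) \<le> exp (- a j * (norm \<theta>)\<^sup>2)"
      using that by (intro decay) auto
    also have "\<dots> \<le> exp (- c * (norm \<theta>)\<^sup>2)"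
      using \<open>c \<le> a j\<close> by (simp add: mult_right_mono)
    finally show ?thesis .
  qed
  have "AE \<omega> in M. eventually (\<lambda>t. norm (walk \<xi> l t \<omega>) \<ge> real R) sequentially" for R
  proof -
    \<comment> \<open>\<open>2 * r \<le> \<epsilon>\<close> keeps \<open>W\<close> on the ball where
      the Gaussian bound holds; \<open>r \<le> 1 / (real R + 1)\<close> turns
      \<open>r * norm x > 1\<close> into \<open>norm x > real R + 1\<close>. As \<open>r\<close>
      depends on \<open>R\<close>, so do \<open>W\<close> and the locale interpretation.\<close>
    define r where "r = min (\<epsilon> / 2) (1 / (real R + 1))"
    have r: "r > 0" "2 * r \<le> \<epsilon>" "r \<le> 1 / (real R + 1)"
      using \<epsilon> by (auto simp: r_def)
    obtain W :: "(real ^ 'd) measure" where W: "prob_space W" "sets W = sets borel"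
        "AE \<theta> in W. norm \<theta> \<le> 2 * r"
        "\<And>h. h \<in> borel_measurable borel \<Longrightarrow>
          (\<integral>\<^sup>+\<theta>. h \<theta> \<partial>W) \<le> (\<integral>\<^sup>+\<theta>. h \<theta> \<partial>lborel) / emeasure lborel (cball (0::real ^ 'd) r)"
        "\<And>x. char_fun W x \<in> \<real>\<^sub>\<ge>\<^sub>0"
        "\<And>x. r * norm x \<le> 1 \<Longrightarrow> 1 / 4 \<le> Re (char_fun W x)"
      using ex_positive_definite_weight[OF r(1)] by blast
    interpret adaptive_walk W J \<mu> M \<xi> F l
      by (intro adaptive_walk.intro weighted_steps.intro adaptive_walk_axioms.intro)
         (fact W(1) W(2) W(5) finJ \<mu> assms(7) hist law indep l)+
    have "AE \<omega> in M. eventually (\<lambda>t. r * norm (walk \<xi> l t \<omega>) > 1) sequentially"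
      using assms(1) J r by (intro eventually_outside_ball[OF r(1) c W(3,4) decay' W(6)]) (auto simp: J_def)
    then show ?thesis
    proof eventually_elim
      case (elim \<omega>)
      then show ?case
      proof eventually_elim
        case (elim t)
        also have "r * norm (walk \<xi> l t \<omega>) \<le> 1 / (real R + 1) * norm (walk \<xi> l t \<omega>)"
          by (rule mult_right_mono[OF r(3)]) simp
        finally show ?case
          by (simp add: field_simps)
      qed
    qed
  qed
  then have "AE \<omega> in M. \<forall>R. eventually (\<lambda>t. norm (walk \<xi> l t \<omega>) \<ge> real R) sequentially"
    by (simp add: AE_all_countable)
  then show ?thesis
    unfolding transient_def
  proof eventually_elim
    case (elim \<omega>)
    show ?case
      unfolding filterlim_at_top
    proof
      fix Z :: real
      obtain R where R: "Z \<le> real R"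
        using real_arch_simple by blast
      show "eventually (\<lambda>t. Z \<le> norm (walk \<xi> l t \<omega>)) sequentially"
        using elim[rule_format, of R] by eventually_elim (use R in simp)
    qed
  qed
qed

end
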